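(* Assume the constraint matrix $\mathbf A$ of the complete problem $P$ is totally unimodular. Let $C>0$ be a constant and define $$P_{\mathrm{distr}}:\quad \min\{\mathbf c^T\mathbf x \mid \mathbf A\mathbf x=\mathbf b,\ \mathbf 0\le \mathbf x\le C\boldsymbol\xi\}.$$ Let $J=\{j_1,\dots,j_K\}$ be drawn i.i.d. from $\boldsymbol\xi$ and let $P_J$ be the column-randomized LP. For any $\delta\in(0,1)$, with probability at least $1-\delta$ over $J$, the following implication holds: if $P_J$ is feasible and $\mathrm{rank}(\mathbf A_J)=m$, then $$\Delta v(P_J)\le\Delta v(P_{\mathrm{distr}})+\frac{C\,(1+m^2\|\mathbf c\|_\infty)}{\sqrt K}\left(1+\sqrt{2\log\frac2\delta}\right).$$
   Context: The complete problem is $P:\ \min\{\mathbf c^T\mathbf x\mid \mathbf A\mathbf x=\mathbf b,\ \mathbf x\ge \mathbf 0\}$ with $\mathbf A\in\mathbb R^{m\times n}$, $\mathbf b\in\mathbb R^m$, $\mathbf c\in\mathbb R^n$. Standing assumptions: $P$ is feasible and bounded, $\mathrm{rank}(\mathbf A)=m$, and $\|\mathbf c\|_2=1$. Totally unimodular means every square submatrix of $\mathbf A$ has determinant $0$, $1$ or $-1$. $\boldsymbol\xi=(\xi_1,\dots,\xi_n)$ is a probability distribution on $[n]=\{1,\dots,n\}$. The indices $j_1,\dots,j_K\in[n]$ are independent with $\Pr[j_k=t]=\xi_t$ (repetitions possible). $\mathbf A_J$ is the matrix whose columns are columns $j_1,\dots,j_K$ of $\mathbf A$, $\mathbf c_J=(c_{j_1},\dots,c_{j_K})$,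 and $P_J:\ \min\{\mathbf c_J^T\tilde{\mathbf x}\mid \mathbf A_J\tilde{\mathbf x}=\mathbf b,\ \tilde{\mathbf x}\ge\mathbf 0\}$. $v(\cdot)$ denotes the optimal value of a problem, with $v=+\infty$ for an infeasible minimization problem, and $\Delta v(P'')=v(P'')-v(P)$. *)

theory Defs
  imports
    "Jordan_Normal_Form.Determinant"
    "HOL-Analysis.Analysis"
    "HOL-Probability.Probability"
begin

(* Both libraries use these symbols; here "$" and "\<bullet>" always mean the HOL-Analysis
   component selection and inner product. *)
no_notation Matrix.vec_index (infixl "$" 100)
no_notation Matrix.scalar_prod (infix "\<bullet>" 70)

(* The order r of a square submatrix varies, so it cannot be an index type; the submatrix is
   therefore a Jordan_Normal_Form matrix, and det is the determinant of that entry.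
   f and g list r distinct rows and r distinct columns of A.  They need not be increasing
   (the index types carry no order): reordering rows and columns only changes the sign. *)
definition totally_unimodular :: "real ^ 'n ^ 'm \<Rightarrow> bool" where
  "totally_unimodular A \<longleftrightarrow>
     (\<forall>(r::nat) (f :: nat \<Rightarrow> 'm) (g :: nat \<Rightarrow> 'n).
        inj_on f {..<r} \<and> inj_on g {..<r} \<longrightarrow>
        Determinant.det (Matrix.mat r r (\<lambda>(i, j). A $ f i $ g j)) \<in> {0, 1, - 1})"

definition lp_feasible_set :: "real ^ 'n ^ 'm \<Rightarrow> real ^ 'm \<Rightarrow> (real ^ 'n) set" where
  "lp_feasible_set A b = {x. A *v x = b \<and> 0 \<le> x}"

definition lp_box_feasible_set ::
    "real ^ 'n ^ 'm \<Rightarrow> real ^ 'm \<Rightarrow> real ^ 'n \<Rightarrow> (real ^ 'n) set" where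
  "lp_box_feasible_set A b u = {x. A *v x = b \<and> 0 \<le> x \<and> x \<le> u}"

(* The infimum in the extended reals, so that the value is \<infinity> on an empty feasible set. *)
definition min_value :: "real ^ 'n \<Rightarrow> (real ^ 'n) set \<Rightarrow> ereal" where
  "min_value c S = (INF x\<in>S. ereal (c \<bullet> x))"

definition lp_value :: "real ^ 'n ^ 'm \<Rightarrow> real ^ 'm \<Rightarrow> real ^ 'n \<Rightarrow> ereal" where
  "lp_value A b c = min_value c (lp_feasible_set A b)"

definition lp_box_value ::
    "real ^ 'n ^ 'm \<Rightarrow> real ^ 'm \<Rightarrow> real ^ 'n \<Rightarrow> real ^ 'n \<Rightarrow> ereal" where
  "lp_box_value A b c u = min_value c (lp_box_feasible_set A b u)"

definition lp_feasible :: "real ^ 'n ^ 'm \<Rightarrow> real ^ 'm \<Rightarrow> bool" where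
  "lp_feasible A b \<longleftrightarrow> lp_feasible_set A b \<noteq> {}"

(* Boundedness of the problem, i.e. of the objective from below, not of the feasible set. *)
definition lp_bounded :: "real ^ 'n ^ 'm \<Rightarrow> real ^ 'm \<Rightarrow> real ^ 'n \<Rightarrow> bool" where
  "lp_bounded A b c \<longleftrightarrow> bdd_below ((\<lambda>x. c \<bullet> x) ` lp_feasible_set A b)"

(* J is a tuple of column indices over the index type 'k and may repeat columns. *)
definition select_columns :: "real ^ 'n ^ 'm \<Rightarrow> ('k \<Rightarrow> 'n) \<Rightarrow> real ^ 'k ^ 'm" where
  "select_columns A J = (\<chi> i k. A $ i $ J k)"

definition select_entries :: "real ^ 'n \<Rightarrow> ('k \<Rightarrow> 'n) \<Rightarrow> real ^ 'k" where
  "select_entries c J = (\<chi> k. c $ J k)"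

end

(*
  Scaling an optimal solution x of the box problem by importance weights gives, for the sample J,
  the nonnegative vector y with entries x_{j_k} / (K xi_{j_k}), bounded by C / K. Then A_J y and
  c_J y are sample means of bounded vectors with expectations b and c x. By a variance bound and
  the bounded differences inequality, each is within O(1 / sqrt K) of its expectation, with
  probability at least 1 - delta / 2.

  It remains to repair y, which is feasible only for the perturbed right-hand side A_J y. The
  difference d between a feasible solution and y solves A_J d = b - A_J y. It can be replaced by a
  vector h between 0 and d, so that y + h stays nonnegative, which is a convex combination of
  solutions with linearly independent support. By Cramer's rule and total unimodularity, each entry
  of those is at most the l1 norm of the right-hand side, so the repair costs at most
  m sqrt m |c|_infinity |b - A_J y|.
*)
theory Submission
  imports Defs
begin

subsection \<open>Right-hand side perturbation of totally unimodular linear programs\<close>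

text \<open>Independence is stated for column indices through the kernel, not for a set of column
  vectors. Equal columns at two indices of \<open>S\<close> therefore count as dependent, as they
  must when a sample repeats columns.\<close>

definition columns_independent :: "real ^ 'n ^ 'm \<Rightarrow> 'n set \<Rightarrow> bool" where
  "columns_independent A S \<longleftrightarrow> (\<forall>e. A *v e = 0 \<and> (\<forall>k. k \<notin> S \<longrightarrow> e $ k = 0) \<longrightarrow> e = 0)"

text \<open>This is the order that protects nonnegativity: if \<open>x\<close> and
  \<open>x + d\<close> are nonnegative and \<open>h\<close> is conformal to \<open>d\<close>, then
  each entry of \<open>x + h\<close> lies between those of \<open>x\<close> and
  \<open>x + d\<close>.\<close>

definition conformal :: "real ^ 'n \<Rightarrow> real ^ 'n \<Rightarrow> bool" where
  "conformal h d \<longleftrightarrow> (\<forall>k. min 0 (d $ k) \<le> h $ k \<and> h $ k \<le> max 0 (d $ k))"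

lemma conformal_refl: "conformal d d"
  by (auto simp: conformal_def min_def max_def)

lemma conformal_trans: "conformal h e \<Longrightarrow> conformal e d \<Longrightarrow> conformal h d"
  unfolding conformal_def by (smt (verit, best))

text \<open>This is the ratio test of the simplex method: one stops at the first moment when a
  coordinate moving towards 0 arrives there, so no coordinate has changed sign yet.\<close>

lemma exists_conformal_step:
  fixes d e :: "real ^ 'n"
  assumes supp: "\<And>k. d $ k = 0 \<Longrightarrow> e $ k = 0" and ex: "d $ k0 * e $ k0 < 0"
  obtains t where "t > 0" "\<And>k. d $ k * (d + t *\<^sub>R e) $ k \<ge> 0"
    "\<exists>k. d $ k \<noteq> 0 \<and> (d + t *\<^sub>R e) $ k = 0"
proof -
  \<comment> \<open>\<open>K\<close> holds the coordinates that the move drives towards 0, and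
    \<open>r k\<close> is the step length at which coordinate \<open>k\<close> reaches it.\<close>
  define K where "K = {k. d $ k * e $ k < 0}"
  define r where "r k = - d $ k / e $ k" for k
  have fin: "finite K" "K \<noteq> {}" using ex by (auto simp: K_def)
  define t where "t = Min (r ` K)"
  have rpos: "r k > 0" if "k \<in> K" for k
    using that by (auto simp: K_def r_def mult_less_0_iff divide_simps)
  have "t \<in> r ` K" using fin by (simp add: t_def)
  then obtain k1 where k1: "k1 \<in> K" "t = r k1" by auto
  have tle: "t \<le> r k" if "k \<in> K" for k using fin that by (simp add: t_def)
  show ?thesis
  proof (rule that[of t])
    show t0: "t > 0" using k1 rpos by simp
    show "\<exists>k. d $ k \<noteq> 0 \<and> (d + t *\<^sub>R e) $ k = 0"
      using k1 by (intro exI[of _ k1]) (auto simp: K_def r_def)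
    show "d $ k * (d + t *\<^sub>R e) $ k \<ge> 0" for k
    proof (cases "k \<in> K")
      case True
      have "t * \<bar>e $ k\<bar> \<le> \<bar>d $ k\<bar>"
        using tle[OF True] True by (auto simp: K_def r_def mult_less_0_iff field_simps)
      then show ?thesis
        using True t0 by (auto simp: K_def mult_less_0_iff abs_if zero_le_mult_iff split: if_splits)
    next
      case False
      then have "0 \<le> d $ k * e $ k" by (simp add: K_def)
      then have "0 \<le> t * (d $ k * e $ k)" using t0 by simp
      moreover have "d $ k * (d + t *\<^sub>R e) $ k = d $ k * d $ k + t * (d $ k * e $ k)"
        by (simp add: algebra_simps)
      ultimately show ?thesis by simp
    qed
  qed
qed

text \<open>If the columns on the support of \<open>d\<close> are dependent, one moves along a kernel vector until a
  coordinate vanishes. Either this shrinks all coordinates, or moving in both directions exhibits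
  \<open>d\<close> as a convex combination of two vectors of smaller support; all of them are conformal, which
  is what keeps the result of the induction between \<open>0\<close> and \<open>d\<close>.\<close>
lemma conformal_solution_bound:
  fixes A :: "real ^ 'n ^ 'm" and d :: "real ^ 'n"
  assumes bound: "\<And>h. A *v h = \<Delta> \<Longrightarrow> columns_independent A {k. h $ k \<noteq> 0} \<Longrightarrow>
      (\<Sum>k\<in>UNIV. \<bar>h $ k\<bar>) \<le> L"
    and "A *v d = \<Delta>"
  shows "\<exists>h. conformal h d \<and> A *v h = \<Delta> \<and> (\<Sum>k\<in>UNIV. \<bar>h $ k\<bar>) \<le> L"
  using assms(2)
proof (induction "card {k. d $ k \<noteq> 0}" arbitrary: d rule: less_induct)
  case less
  show ?case
  proof (cases "columns_independent A {k. d $ k \<noteq> 0}")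
    case True
    then show ?thesis using bound[of d] less.prems conformal_refl by auto
  next
    case False
    then obtain e' where e': "A *v e' = 0" "\<And>k. d $ k = 0 \<Longrightarrow> e' $ k = 0" "e' \<noteq> 0"
      by (auto simp: columns_independent_def)
    obtain k0 where k0: "e' $ k0 \<noteq> 0" using e'(3) by (auto simp: vec_eq_iff)
    have d0: "d $ k0 \<noteq> 0" using e'(2) k0 by auto
    \<comment> \<open>The kernel vector is oriented so that moving along it pushes coordinate
      \<open>k0\<close> of \<open>d\<close> towards 0, which the ratio test requires.\<close>
    obtain e where e: "A *v e = 0" "\<And>k. d $ k = 0 \<Longrightarrow> e $ k = 0" "d $ k0 * e $ k0 < 0"
    proof (cases "d $ k0 * e' $ k0 < 0")
      case True
      then show ?thesis using that[of e'] e' by auto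
    next
      case False
      have "A *v (- e') = 0"
        using e'(1) by (metis matrix_vector_mult_diff_distrib diff_0 diff_self
            matrix_vector_mult_0_right)
      moreover have "d $ k0 * e' $ k0 \<noteq> 0" using k0 d0 by simp
      with False have "d $ k0 * e' $ k0 > 0" by linarith
      ultimately show ?thesis using e'(2) by (intro that[of "- e'"]) auto
    qed
    have Ae: "A *v (d + t *\<^sub>R e) = \<Delta>" for t
      using less.prems e(1)
      by (simp add: matrix_vector_right_distrib matrix_vector_mult_scaleR)
    have smaller: "card {k. (d + t *\<^sub>R e) $ k \<noteq> 0} < card {k. d $ k \<noteq> 0}"
      if "\<exists>k. d $ k \<noteq> 0 \<and> (d + t *\<^sub>R e) $ k = 0" for t
    proof (rule psubset_card_mono)
      show "{k. (d + t *\<^sub>R e) $ k \<noteq> 0} \<subset> {k. d $ k \<noteq> 0}"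
        using e(2) that by auto
    qed auto
    obtain t where t: "t > 0" "\<And>k. d $ k * (d + t *\<^sub>R e) $ k \<ge> 0"
      "\<exists>k. d $ k \<noteq> 0 \<and> (d + t *\<^sub>R e) $ k = 0"
      using exists_conformal_step[OF e(2,3)] by blast
    obtain h1 where h1: "conformal h1 (d + t *\<^sub>R e)" "A *v h1 = \<Delta>" "(\<Sum>k\<in>UNIV. \<bar>h1 $ k\<bar>) \<le> L"
      using less.hyps[OF smaller[OF t(3)] Ae] by blast
    show ?thesis
    proof (cases "\<exists>k. d $ k * (- e) $ k < 0")
      case False
      have "conformal (d + t *\<^sub>R e) d"
        unfolding conformal_def
      proof (intro allI)
        fix k
        have "d $ k * e $ k \<le> 0" using False by (auto simp: not_less)
        then have "d $ k * (t * e $ k) \<le> 0"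
          using t(1) by (smt (verit) mult.left_commute mult_pos_pos zero_less_mult_iff)
        then show "min 0 (d $ k) \<le> (d + t *\<^sub>R e) $ k \<and> (d + t *\<^sub>R e) $ k \<le> max 0 (d $ k)"
          using t(2)[of k] e(2)[of k]
          by (cases "d $ k" "0 :: real" rule: linorder_cases)
             (auto simp: zero_le_mult_iff mult_le_0_iff min_def max_def)
      qed
      then show ?thesis using h1 conformal_trans by blast
    next
      case True
      then obtain k1 where k1: "d $ k1 * (- e) $ k1 < 0" by blast
      obtain s where s: "s > 0" "\<And>k. d $ k * (d + s *\<^sub>R (- e)) $ k \<ge> 0"
        "\<exists>k. d $ k \<noteq> 0 \<and> (d + s *\<^sub>R (- e)) $ k = 0"
        using exists_conformal_step[OF _ k1] e(2) by (metis neg_equal_0_iff_equal vector_uminus_component)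
      have se: "d + s *\<^sub>R (- e) = d + (- s) *\<^sub>R e" by simp
      obtain h2 where h2: "conformal h2 (d + s *\<^sub>R (- e))" "A *v h2 = \<Delta>"
        "(\<Sum>k\<in>UNIV. \<bar>h2 $ k\<bar>) \<le> L"
        using less.hyps[OF smaller Ae, of "- s"] s(3) unfolding se by blast
      \<comment> \<open>The weights make the two opposite moves cancel: since
        \<open>a * t = c * s\<close>, the combination of \<open>d + t *\<^sub>R e\<close> and
        \<open>d - s *\<^sub>R e\<close> with weights \<open>a\<close> and \<open>c\<close> is
        \<open>d\<close>.\<close>
      define a where "a = s / (s + t)"
      define c where "c = t / (s + t)"
      have ac: "a > 0" "c > 0" "a + c = 1" "a * t = c * s"
        using s(1) t(1)
        by (simp_all add: a_def c_def add_divide_distrib[symmetric] mult.commute)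
      define h where "h = a *\<^sub>R h1 + c *\<^sub>R h2"
      have "A *v h = (a + c) *\<^sub>R \<Delta>"
        using h1 h2 by (simp add: h_def matrix_vector_right_distrib matrix_vector_mult_scaleR algebra_simps)
      then have Ah: "A *v h = \<Delta>" using ac by simp
      have "(\<Sum>k\<in>UNIV. \<bar>h $ k\<bar>) \<le> (\<Sum>k\<in>UNIV. a * \<bar>h1 $ k\<bar> + c * \<bar>h2 $ k\<bar>)"
      proof (rule sum_mono)
        fix k show "\<bar>h $ k\<bar> \<le> a * \<bar>h1 $ k\<bar> + c * \<bar>h2 $ k\<bar>"
          using abs_triangle_ineq[of "a * h1 $ k" "c * h2 $ k"] ac by (simp add: h_def abs_mult)
      qed
      also have "\<dots> = a * (\<Sum>k\<in>UNIV. \<bar>h1 $ k\<bar>) + c * (\<Sum>k\<in>UNIV. \<bar>h2 $ k\<bar>)"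
        by (simp add: sum.distrib sum_distrib_left)
      also have "\<dots> \<le> a * L + c * L"
        using h1(3) h2(3) ac by (intro add_mono mult_left_mono) auto
      also have "\<dots> = L" using ac by (metis distrib_right mult_1)
      finally have hL: "(\<Sum>k\<in>UNIV. \<bar>h $ k\<bar>) \<le> L" .
      have "conformal h d"
        unfolding conformal_def
      proof (intro allI)
        fix k
        define u where "u = (d + t *\<^sub>R e) $ k"
        define v where "v = (d + s *\<^sub>R (- e)) $ k"
        have "a * u + c * v = (a + c) * d $ k + (a * t - c * s) * e $ k"
          by (simp add: u_def v_def algebra_simps)
        then have dk: "d $ k = a * u + c * v" using ac by simp
        have uv: "min 0 u \<le> h1 $ k" "h1 $ k \<le> max 0 u" "min 0 v \<le> h2 $ k" "h2 $ k \<le> max 0 v"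
          using h1(1) h2(1) unfolding conformal_def u_def v_def by blast+
        have sg: "d $ k * u \<ge> 0" "d $ k * v \<ge> 0" "d $ k = 0 \<Longrightarrow> u = 0 \<and> v = 0"
          using t(2)[of k] s(2)[of k] e(2)[of k] unfolding u_def v_def by auto
        have mono: "a * x \<le> a * y" "c * x \<le> c * y" if "x \<le> y" for x y
          using that ac by auto
        \<comment> \<open>Neither move crosses 0, so \<open>u\<close>, \<open>v\<close> and
          \<open>d $ k\<close> have a common sign. This is why conformality to the two endpoints
          passes to their convex combination.\<close>
        consider "0 \<le> u" "0 \<le> v" "0 \<le> d $ k" | "u \<le> 0" "v \<le> 0" "d $ k \<le> 0"
          using sg by (cases "d $ k" "0 :: real" rule: linorder_cases) (auto simp: zero_le_mult_iff)
        then show "min 0 (d $ k) \<le> h $ k \<and> h $ k \<le> max 0 (d $ k)"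
        proof cases
          case 1
          then show ?thesis
            using uv mono(1)[of 0 "h1 $ k"] mono(2)[of 0 "h2 $ k"] mono(1)[of "h1 $ k" u]
              mono(2)[of "h2 $ k" v] dk by (auto simp: h_def)
        next
          case 2
          then show ?thesis
            using uv mono(1)[of "h1 $ k" 0] mono(2)[of "h2 $ k" 0] mono(1)[of u "h1 $ k"]
              mono(2)[of v "h2 $ k"] dk by (auto simp: h_def)
        qed
      qed
      then show ?thesis using Ah hL by blast
    qed
  qed
qed

section \<open>Nonsingular minors and Cramer's rule\<close>

text \<open>Row rank equals column rank on the columns in \<open>S\<close>. The rows, cut down to
  \<open>S\<close>, span the coordinate subspace \<open>V\<close>: a nonzero vector of
  \<open>V\<close> orthogonal to all of them would be a kernel vector of \<open>A\<close> supported
  in \<open>S\<close>. A basis chosen among these rows gives the row list \<open>f\<close>.\<close>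

lemma columns_independent_nonsingular_submatrix:
  fixes A :: "real ^ 'n ^ 'm"
  assumes ind: "columns_independent A S"
  obtains f g where "bij_betw g {..<card S} S" "inj_on f {..<card S}"
    "Determinant.det (Matrix.mat (card S) (card S) (\<lambda>(i, j). A $ f i $ g j)) \<noteq> 0"
proof -
  define r where "r = card S"
  define v where "v i = (\<chi> k. if k \<in> S then A $ i $ k else 0)" for i
  define V where "V = {x :: real ^ 'n. \<forall>k. k \<notin> S \<longrightarrow> x $ k = 0}"
  have subV: "subspace V" by (auto simp: V_def subspace_def)
  have dimV: "dim V = r" 
    using dim_substandard_cart[where 'a = real and d = S] by (simp add: V_def r_def dim_vec_eq)
  have sV: "span V = V" using subV by (simp add: span_eq_iff)
  have vx: "v i \<bullet> x = (A *v x) $ i" if "x \<in> V" for x i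
    using that unfolding v_def V_def inner_vec_def matrix_vector_mult_def
    by (auto intro!: sum.cong)
  have spanV: "span (range v) = V"
  proof (rule ccontr)
    assume "span (range v) \<noteq> V"
    moreover have "span (range v) \<subseteq> V"
      by (rule span_minimal[OF _ subV]) (auto simp: v_def V_def)
    ultimately have "span (range v) \<subset> span V" by (simp add: sV psubset_eq)
    then obtain x where x: "x \<noteq> 0" "x \<in> span V" "\<And>y. y \<in> span (range v) \<Longrightarrow> orthogonal x y"
      using orthogonal_to_subspace_exists_gen by blast
    have xV: "x \<in> V" using x(2) sV by simp
    have "(A *v x) $ i = 0" for i
      using x(3)[OF span_base, of "v i"] vx[OF xV, of i]
      by (simp add: orthogonal_def inner_commute)
    then have "A *v x = 0" by (simp add: vec_eq_iff)
    then show False using ind xV x(1) by (auto simp: columns_independent_def V_def)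
  qed
  obtain B where B: "B \<subseteq> range v" "independent B" "range v \<subseteq> span B" "card B = dim (range v)"
    by (rule basis_exists)
  \<comment> \<open>Different rows of \<open>A\<close> may agree on \<open>S\<close>, so one index
    is picked for each basis vector.\<close>
  obtain U where U: "inj_on v U" "B = v ` U" using B(1) subset_image_inj[of B v UNIV] by auto
  have "dim (range v) = r" using spanV dimV by (metis dim_span)
  then have cU: "card U = r" using B(4) U card_image by metis
  have VB: "V \<subseteq> span B" using B(3) spanV by (metis span_minimal subspace_span)
  obtain f where f: "bij_betw f {..<r} U"
    using ex_bij_betw_nat_finite[of U] cU by (auto simp: atLeast0LessThan)
  obtain g where g: "bij_betw g {..<r} S"
    using ex_bij_betw_nat_finite[of S] by (auto simp: atLeast0LessThan r_def)
  define M where "M = Matrix.mat r r (\<lambda>(i, j). A $ f i $ g j)"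
  have "Determinant.det M \<noteq> 0"
  proof
    assume "Determinant.det M = 0"
    moreover have "M \<in> carrier_mat r r" by (simp add: M_def)
    ultimately obtain w where w: "w \<in> carrier_vec r" "w \<noteq> 0\<^sub>v r" "M *\<^sub>v w = 0\<^sub>v r"
      using det_0_iff_vec_prod_zero by blast
    \<comment> \<open>A kernel vector of \<open>M\<close>, spread over \<open>S\<close> along
      \<open>g\<close> and zero elsewhere, lies in \<open>V\<close> and is orthogonal to a basis of
      \<open>V\<close>. It is thus orthogonal to itself.\<close>
    define x :: "real ^ 'n" where
      "x = (\<chi> k. if k \<in> S then Matrix.vec_index w (inv_into {..<r} g k) else 0)"
    have xg: "x $ g j = Matrix.vec_index w j" if "j < r" for j
      using that g by (auto simp: x_def bij_betw_def)
    have xV: "x \<in> V" by (simp add: V_def x_def)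
    have "v (f i) \<bullet> x = 0" if "i < r" for i
    proof -
      have "v (f i) \<bullet> x = (\<Sum>k\<in>S. A $ f i $ k * x $ k)"
        unfolding v_def inner_vec_def by (auto intro!: sum.mono_neutral_cong_right)
      also have "\<dots> = (\<Sum>j<r. A $ f i $ g j * x $ g j)"
        by (rule sum.reindex_bij_betw[OF g, symmetric])
      also have "\<dots> = Matrix.vec_index (M *\<^sub>v w) i"
        using that w(1) xg by (auto simp: M_def scalar_prod_def atLeast0LessThan intro!: sum.cong)
      finally show ?thesis using w(3) that by simp
    qed
    then have "y \<bullet> x = 0" if "y \<in> B" for y
      using that U(2) f by (auto simp: bij_betw_def)
    then have "y \<bullet> x = 0" if "y \<in> span B" for y
      using that by (metis orthogonal_def orthogonal_to_span inner_commute)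
    then have "x = 0" using xV VB by (metis inner_eq_zero_iff subsetD)
    then have "w = 0\<^sub>v r" using w(1) xg by (intro eq_vecI) auto
    then show False using w(2) by simp
  qed
  moreover have "inj_on f {..<r}" using f by (simp add: bij_betw_def)
  ultimately show ?thesis using that g by (simp add: M_def r_def)
qed

text \<open>On its support, \<open>h\<close> solves a square system whose determinant is 1 or -1, so
  Cramer's rule involves no division. Expanding along the replaced column leaves cofactors of
  absolute value at most 1. The size bound holds because the square system uses distinct
  rows.\<close>

lemma totally_unimodular_solution_bound:
  fixes A :: "real ^ 'n ^ 'm"
  assumes TU: "totally_unimodular A" and ind: "columns_independent A {k. h $ k \<noteq> 0}"
  shows "\<bar>h $ k\<bar> \<le> (\<Sum>i\<in>UNIV. \<bar>(A *v h) $ i\<bar>)" "card {k. h $ k \<noteq> 0} \<le> CARD('m)"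
proof -
  define S where "S = {k. h $ k \<noteq> 0}"
  define r where "r = card S"
  obtain f g where g: "bij_betw g {..<r} S" and f: "inj_on f {..<r}"
    and nz: "Determinant.det (Matrix.mat r r (\<lambda>(i, j). A $ f i $ g j)) \<noteq> 0"
    using columns_independent_nonsingular_submatrix[of A S] ind unfolding S_def r_def by metis
  have ginj: "inj_on g {..<r}" using g by (simp add: bij_betw_def)
  have "card (f ` {..<r}) \<le> card (UNIV :: 'm set)" by (rule card_mono) auto
  then show "card {k. h $ k \<noteq> 0} \<le> CARD('m)" using f by (simp add: card_image r_def S_def)
  define M where "M = Matrix.mat r r (\<lambda>(i, j). A $ f i $ g j)"
  have M: "M \<in> carrier_mat r r" by (simp add: M_def)
  have "Determinant.det M \<in> {0, 1, - 1}" using TU f ginj unfolding totally_unimodular_def M_def by blast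
  then have det1: "\<bar>Determinant.det M\<bar> = 1" using nz unfolding M_def[symmetric] by auto
  show "\<bar>h $ k\<bar> \<le> (\<Sum>i\<in>UNIV. \<bar>(A *v h) $ i\<bar>)"
  proof (cases "k \<in> S")
    case False
    then show ?thesis by (simp add: S_def sum_nonneg)
  next
    case True
    then obtain l where l: "l < r" "g l = k" using g by (auto simp: bij_betw_def)
    define x where "x = Matrix.vec r (\<lambda>j. h $ g j)"
    have x: "x \<in> carrier_vec r" by (simp add: x_def)
    have Mx: "Matrix.vec_index (M *\<^sub>v x) i = (A *v h) $ f i" if "i < r" for i
    proof -
      have "(A *v h) $ f i = (\<Sum>k\<in>S. A $ f i $ k * h $ k)"
        unfolding matrix_vector_mult_def by (auto simp: S_def intro!: sum.mono_neutral_right)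
      also have "\<dots> = (\<Sum>j<r. A $ f i $ g j * h $ g j)"
        by (rule sum.reindex_bij_betw[OF g, symmetric])
      also have "\<dots> = Matrix.vec_index (M *\<^sub>v x) i"
        using that by (auto simp: M_def x_def scalar_prod_def atLeast0LessThan intro!: sum.cong)
      finally show ?thesis by simp
    qed
    define R where "R = replace_col M (M *\<^sub>v x) l"
    have R: "R \<in> carrier_mat r r" using M by (simp add: R_def replace_col_def)
    \<comment> \<open>The cofactor deletes column \<open>l\<close>, the only one in which
      \<open>R\<close> differs from \<open>M\<close>. What remains is a submatrix of
      \<open>A\<close>, with \<open>insert_index\<close> skipping the deleted row and
      column.\<close>
    have cof: "\<bar>cofactor R i l\<bar> \<le> 1" if i: "i < r" for i
    proof -
      define f' where "f' = f \<circ> insert_index i"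
      define g' where "g' = g \<circ> insert_index l"
      have "inj_on f' {..<r - 1}" unfolding f'_def
        by (rule comp_inj_on[OF insert_index_inj_on], rule inj_on_subset[OF f])
           (auto simp: insert_index_def)
      moreover have "inj_on g' {..<r - 1}" unfolding g'_def
        by (rule comp_inj_on[OF insert_index_inj_on], rule inj_on_subset[OF ginj])
           (auto simp: insert_index_def)
      ultimately have
        "Determinant.det (Matrix.mat (r - 1) (r - 1) (\<lambda>(i, j). A $ f' i $ g' j)) \<in> {0, 1, - 1}"
        using TU unfolding totally_unimodular_def by blast
      moreover have "mat_delete R i l = Matrix.mat (r - 1) (r - 1) (\<lambda>(i, j). A $ f' i $ g' j)"
        by (rule eq_matI)
           (auto simp: mat_delete_def R_def replace_col_def M_def f'_def g'_def insert_index_def)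
      ultimately show ?thesis unfolding cofactor_def by (auto simp: abs_mult power_abs)
    qed
    have "\<bar>h $ k\<bar> = \<bar>Matrix.vec_index x l * Determinant.det M\<bar>"
      using det1 l by (simp add: abs_mult x_def)
    also have "Matrix.vec_index x l * Determinant.det M = Determinant.det R"
      unfolding R_def by (rule cramer_lemma_mat[OF M x l(1), symmetric])
    also have "\<dots> = (\<Sum>i<r. R $$ (i, l) * cofactor R i l)"
      by (rule laplace_expansion_column[OF R l(1)])
    also have "\<bar>\<dots>\<bar> \<le> (\<Sum>i<r. \<bar>(A *v h) $ f i\<bar> * 1)"
    proof (rule order_trans[OF sum_abs sum_mono])
      fix i assume "i \<in> {..<r}"
      then have i: "i < r" by simp
      have "R $$ (i, l) = (A *v h) $ f i"
        using i l M Mx[OF i] by (simp add: R_def replace_col_def)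
      then show "\<bar>R $$ (i, l) * cofactor R i l\<bar> \<le> \<bar>(A *v h) $ f i\<bar> * 1"
        using cof[OF i] by (simp only: abs_mult) (rule mult_left_mono, auto)
    qed
    also have "\<dots> = (\<Sum>i\<in>f ` {..<r}. \<bar>(A *v h) $ i\<bar>)"
      using f by (simp add: sum.reindex)
    also have "\<dots> \<le> (\<Sum>i\<in>UNIV. \<bar>(A *v h) $ i\<bar>)"
      by (rule sum_mono2) auto
    finally show ?thesis .
  qed
qed

lemma totally_unimodular_entry_le_1:
  assumes "totally_unimodular A"
  shows "\<bar>A $ i $ k\<bar> \<le> 1"
proof -
  have "Determinant.det (Matrix.mat 1 1 (\<lambda>(i', j'). A $ i $ k)) \<in> {0, 1, - 1}"
    by (rule assms[unfolded totally_unimodular_def, rule_format, of "\<lambda>_. i" 1 "\<lambda>_. k"])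
       (auto simp: inj_on_def)
  then show ?thesis by (subst (asm) det_single) auto
qed

text \<open>A square submatrix either uses distinct columns of \<open>A\<close> and is a submatrix
  of \<open>A\<close>, or contains a repeated column and has determinant 0.\<close>

lemma totally_unimodular_select_columns:
  fixes A :: "real ^ 'n ^ 'm" and J :: "'k::finite \<Rightarrow> 'n"
  assumes TU: "totally_unimodular A"
  shows "totally_unimodular (select_columns A J)"
  unfolding totally_unimodular_def
proof (intro allI impI)
  fix r :: nat and f :: "nat \<Rightarrow> 'm" and g :: "nat \<Rightarrow> 'k"
  assume fg: "inj_on f {..<r} \<and> inj_on g {..<r}"
  define M where "M = Matrix.mat r r (\<lambda>(i, j). select_columns A J $ f i $ g j)"
  have M: "M = Matrix.mat r r (\<lambda>(i, j). A $ f i $ (J \<circ> g) j)"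
    by (simp add: M_def select_columns_def)
  have "Determinant.det M \<in> {0, 1, - 1}"
  proof (cases "inj_on (J \<circ> g) {..<r}")
    case True
    then show ?thesis using TU fg unfolding totally_unimodular_def M by blast
  next
    case False
    then obtain p q where pq: "p < r" "q < r" "p \<noteq> q" "J (g p) = J (g q)"
      by (auto simp: inj_on_def)
    have "Determinant.det M = 0"
    proof (rule Determinant.det_identical_columns[of _ r p q])
      show "col M p = col M q" using pq by (intro eq_vecI) (auto simp: M)
    qed (use pq in \<open>auto simp: M\<close>)
    then show ?thesis by simp
  qed
  then show "Determinant.det (Matrix.mat r r (\<lambda>(i, j). select_columns A J $ f i $ g j)) \<in> {0, 1, - 1}"
    by (simp add: M_def)
qed

section \<open>Repairing a nonnegative point that violates the equality constraints\<close>

lemma sum_abs_le_sqrt_card_norm: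
  fixes x :: "real ^ 'm"
  shows "(\<Sum>i\<in>UNIV. \<bar>x $ i\<bar>) \<le> sqrt (real CARD('m)) * norm x"
proof -
  have "(\<Sum>i\<in>UNIV. \<bar>1\<bar> * \<bar>x $ i\<bar>) \<le> L2_set (\<lambda>_. 1) (UNIV :: 'm set) * L2_set (\<lambda>i. x $ i) UNIV"
    by (rule L2_set_mult_ineq)
  then show ?thesis by (simp add: norm_vec_def L2_set_def)
qed

text \<open>The move from \<open>x\<close> to any feasible \<open>y\<close> may be long, but a
  conformal replacement \<open>h\<close> has l1 norm at most m times that of the residual: at most m
  nonzero entries in each independent solution, each bounded by Cramer's rule. Passing from l1 to
  Euclidean norm costs the further factor sqrt m.\<close>

lemma totally_unimodular_lp_value_le:
  fixes A :: "real ^ 'n ^ 'm"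
  assumes TU: "totally_unimodular A" and feas: "lp_feasible A b" and x: "0 \<le> x"
    and c: "\<And>k. \<bar>c $ k\<bar> \<le> \<gamma>"
  shows "lp_value A b c
    \<le> ereal (c \<bullet> x + \<gamma> * real CARD('m) * sqrt (real CARD('m)) * norm (A *v x - b))"
proof -
  define \<Delta> where "\<Delta> = b - A *v x"
  define s where "s = (\<Sum>i\<in>UNIV. \<bar>\<Delta> $ i\<bar>)"
  have s0: "s \<ge> 0" by (simp add: s_def sum_nonneg)
  obtain y where y: "A *v y = b" "0 \<le> y"
    using feas by (auto simp: lp_feasible_def lp_feasible_set_def)
  have "\<exists>h. conformal h (y - x) \<and> A *v h = \<Delta> \<and> (\<Sum>k\<in>UNIV. \<bar>h $ k\<bar>) \<le> real CARD('m) * s"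
  proof (rule conformal_solution_bound)
    show "A *v (y - x) = \<Delta>" by (simp add: matrix_vector_mult_diff_distrib y \<Delta>_def)
    fix h assume h: "A *v h = \<Delta>" "columns_independent A {k. h $ k \<noteq> 0}"
    note tu = totally_unimodular_solution_bound[OF TU h(2)]
    have "(\<Sum>k\<in>UNIV. \<bar>h $ k\<bar>) = (\<Sum>k | h $ k \<noteq> 0. \<bar>h $ k\<bar>)"
      by (rule sum.mono_neutral_right) auto
    also have "\<dots> \<le> (\<Sum>k | h $ k \<noteq> 0. s)"
      using tu(1) by (intro sum_mono) (simp add: h s_def)
    also have "\<dots> \<le> real CARD('m) * s"
      using tu(2) s0 by (simp add: mult_right_mono)
    finally show "(\<Sum>k\<in>UNIV. \<bar>h $ k\<bar>) \<le> real CARD('m) * s" .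
  qed
  then obtain h where h: "conformal h (y - x)" "A *v h = \<Delta>"
    "(\<Sum>k\<in>UNIV. \<bar>h $ k\<bar>) \<le> real CARD('m) * s" by blast
  \<comment> \<open>Each entry of \<open>x + h\<close> lies between the corresponding entries of
    \<open>x\<close> and \<open>y\<close>, both nonnegative.\<close>
  have "0 \<le> (x + h) $ k" for k
    using h(1) x y(2) unfolding conformal_def less_eq_vec_def
    by (smt (verit) vector_add_component vector_minus_component zero_index)
  then have "x + h \<in> lp_feasible_set A b"
    using h(2) by (simp add: lp_feasible_set_def matrix_vector_right_distrib \<Delta>_def less_eq_vec_def)
  then have "lp_value A b c \<le> ereal (c \<bullet> (x + h))"
    unfolding lp_value_def min_value_def by (rule INF_lower)
  also have "c \<bullet> h \<le> \<gamma> * (real CARD('m) * (sqrt (real CARD('m)) * norm \<Delta>))"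
  proof -
    have g0: "\<gamma> \<ge> 0" using c[of undefined] by linarith
    have "c \<bullet> h \<le> (\<Sum>k\<in>UNIV. \<gamma> * \<bar>h $ k\<bar>)"
      unfolding inner_vec_def
    proof (rule sum_mono)
      fix k
      have "c $ k * h $ k \<le> \<bar>c $ k\<bar> * \<bar>h $ k\<bar>" by (metis abs_ge_self abs_mult)
      also have "\<dots> \<le> \<gamma> * \<bar>h $ k\<bar>" by (rule mult_right_mono[OF c]) simp
      finally show "c $ k \<bullet> h $ k \<le> \<gamma> * \<bar>h $ k\<bar>" by simp
    qed
    also have "\<dots> = \<gamma> * (\<Sum>k\<in>UNIV. \<bar>h $ k\<bar>)" by (simp add: sum_distrib_left)
    also have "\<dots> \<le> \<gamma> * (real CARD('m) * s)" by (rule mult_left_mono[OF h(3) g0])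
    also have "\<dots> \<le> \<gamma> * (real CARD('m) * (sqrt (real CARD('m)) * norm \<Delta>))"
      unfolding s_def by (intro mult_left_mono sum_abs_le_sqrt_card_norm g0) auto
    finally show ?thesis .
  qed
  then have "ereal (c \<bullet> (x + h))
      \<le> ereal (c \<bullet> x + \<gamma> * real CARD('m) * sqrt (real CARD('m)) * norm \<Delta>)"
    by (simp add: inner_add_right mult.assoc)
  finally show ?thesis by (simp add: \<Delta>_def norm_minus_commute)
qed

subsection \<open>Bounded differences and sample means\<close>

lemma integrable_finite_pmf:
  fixes p :: "'a::finite pmf" and f :: "'a \<Rightarrow> 'b::{banach, second_countable_topology}"
  shows "integrable (measure_pmf p) f"
  by (rule integrable_measure_pmf_finite) simp

lemma finite_set_Pi_pmf:
  fixes p :: "'i \<Rightarrow> 'a::finite pmf"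
  assumes "finite I"
  shows "finite (set_pmf (Pi_pmf I d p))"
  using assms by (subst set_Pi_pmf) auto

lemma integrable_Pi_pmf:
  fixes p :: "'i \<Rightarrow> 'a::finite pmf" and f :: "('i \<Rightarrow> 'a) \<Rightarrow> 'b::{banach, second_countable_topology}"
  assumes "finite I"
  shows "integrable (measure_pmf (Pi_pmf I d p)) f"
  by (rule integrable_measure_pmf_finite[OF finite_set_Pi_pmf[OF assms]])

text \<open>Fubini for one added coordinate; it drives the inductions over the index set.\<close>

lemma expectation_Pi_pmf_insert:
  fixes p :: "'i \<Rightarrow> 'a::finite pmf" and f :: "('i \<Rightarrow> 'a) \<Rightarrow> 'b::{banach, second_countable_topology}"
  assumes "finite I" "a \<notin> I"
  shows "measure_pmf.expectation (Pi_pmf (insert a I) d p) f =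
    measure_pmf.expectation (p a) (\<lambda>y. measure_pmf.expectation (Pi_pmf I d p) (\<lambda>x. f (x(a := y))))"
proof -
  have "Pi_pmf (insert a I) d p = p a \<bind> (\<lambda>y. map_pmf (\<lambda>x. x(a := y)) (Pi_pmf I d p))"
    using assms by (simp add: Pi_pmf_insert' map_pmf_def)
  also have "measure_pmf.expectation \<dots> f =
      (\<Sum>y\<in>UNIV. pmf (p a) y *\<^sub>R
        measure_pmf.expectation (map_pmf (\<lambda>x. x(a := y)) (Pi_pmf I d p)) f)"
    by (rule pmf_expectation_bind) (use finite_set_Pi_pmf[OF assms(1)] in auto)
  also have "\<dots> = measure_pmf.expectation (p a)
      (\<lambda>y. measure_pmf.expectation (Pi_pmf I d p) (\<lambda>x. f (x(a := y))))"
    by (subst integral_measure_pmf[of UNIV]) auto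
  finally show ?thesis .
qed

text \<open>The martingale argument appears as an induction over coordinates. The deviation of
  \<open>f\<close> splits into \<open>f - g\<close>, handled by the induction hypothesis for each
  fixed value of coordinate \<open>a\<close>, and \<open>g\<close> minus its mean, handled by
  Hoeffding's lemma.\<close>

lemma bounded_differences_exp_moment:
  fixes p :: "'i \<Rightarrow> 'a::finite pmf" and f :: "('i \<Rightarrow> 'a) \<Rightarrow> real"
  assumes "finite I" and l: "l > 0"
    and "\<And>i x y z. i \<in> I \<Longrightarrow> \<bar>f (x(i := y)) - f (x(i := z))\<bar> \<le> c i"
  shows "measure_pmf.expectation (Pi_pmf I d p)
      (\<lambda>x. exp (l * (f x - measure_pmf.expectation (Pi_pmf I d p) f)))
    \<le> exp (l\<^sup>2 * (\<Sum>i\<in>I. (c i)\<^sup>2) / 8)"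
  using assms(1,3)
proof (induction I arbitrary: f rule: finite_induct)
  case empty
  then show ?case by simp
next
  case (insert a I)
  let ?E = "measure_pmf.expectation (Pi_pmf I d p)"
  let ?Ea = "measure_pmf.expectation (p a)"
  note int = integrable_Pi_pmf[OF insert.hyps(1)]
  \<comment> \<open>\<open>g y\<close> is the conditional expectation of \<open>f\<close> given that
    coordinate \<open>a\<close> has value \<open>y\<close>.\<close>
  define g where "g y = ?E (\<lambda>x. f (x(a := y)))" for y
  have mean: "measure_pmf.expectation (Pi_pmf (insert a I) d p) f = ?Ea g"
    using insert.hyps by (simp add: expectation_Pi_pmf_insert g_def[abs_def])
  have inner: "?E (\<lambda>x. exp (l * (f (x(a := y)) - g y))) \<le> exp (l\<^sup>2 * (\<Sum>i\<in>I. (c i)\<^sup>2) / 8)" for y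
    unfolding g_def
  proof (rule insert.IH)
    fix i x u v assume "i \<in> I"
    then have "i \<noteq> a" using insert.hyps by auto
    then have "(x(i := w))(a := y) = (x(a := y))(i := w)" for w by (rule fun_upd_twist)
    then show "\<bar>f ((x(i := u))(a := y)) - f ((x(i := v))(a := y))\<bar> \<le> c i"
      using insert.prems[of i "x(a := y)" u v] \<open>i \<in> I\<close> by (simp del: fun_upd_apply)
  qed
  have diff: "g y \<le> g z + c a" for y z
  proof -
    have "g y \<le> ?E (\<lambda>x. f (x(a := z)) + c a)"
      unfolding g_def
    proof (rule integral_mono[OF int int])
      fix x show "f (x(a := y)) \<le> f (x(a := z)) + c a"
        using insert.prems[OF insertI1, of x y z] by linarith
    qed
    also have "\<dots> = g z + c a" by (simp add: g_def int)
    finally show ?thesis .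
  qed
  \<comment> \<open>By \<open>diff\<close> the values of \<open>g\<close> lie in an interval of
    length \<open>c a\<close>, not \<open>2 * c a\<close>; this gives the denominator 8 and hence
    the sharp constant in the exponent.\<close>
  define m where "m = Min (range g)"
  have mle: "m \<le> g y" for y by (simp add: m_def)
  have "m \<in> range g" unfolding m_def by (rule Min_in) auto
  then have lem: "g y \<le> m + c a" for y using diff by auto
  interpret interval_bounded_random_variable "measure_pmf (p a)" g m "m + c a"
    by unfold_locales (auto simp: mle lem)
  have "ennreal (?Ea (\<lambda>y. exp (l * (g y - ?Ea g)))) =
      nn_integral (measure_pmf (p a)) (\<lambda>y. exp (l * (g y - ?Ea g)))"
    by (rule nn_integral_eq_integral[symmetric]) (auto intro: integrable_finite_pmf)
  also have "\<dots> \<le> ennreal (exp (l\<^sup>2 * (m + c a - m)\<^sup>2 / 8))"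
    by (rule Hoeffdings_lemma_nn_integral[OF l])
  finally have outer: "?Ea (\<lambda>y. exp (l * (g y - ?Ea g))) \<le> exp (l\<^sup>2 * (c a)\<^sup>2 / 8)"
    by simp
  have "measure_pmf.expectation (Pi_pmf (insert a I) d p) (\<lambda>x. exp (l * (f x - ?Ea g)))
      = ?Ea (\<lambda>y. ?E (\<lambda>x. exp (l * (f (x(a := y)) - ?Ea g))))"
    using insert.hyps by (simp add: expectation_Pi_pmf_insert)
  also have "\<dots> = ?Ea (\<lambda>y. exp (l * (g y - ?Ea g)) * ?E (\<lambda>x. exp (l * (f (x(a := y)) - g y))))"
  proof -
    have "exp (l * (f (x(a := y)) - ?Ea g)) = exp (l * (g y - ?Ea g)) * exp (l * (f (x(a := y)) - g y))"
      for x y by (simp add: exp_add[symmetric] distrib_left[symmetric])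
    then show ?thesis by simp
  qed
  also have "\<dots> \<le> ?Ea (\<lambda>y. exp (l * (g y - ?Ea g)) * exp (l\<^sup>2 * (\<Sum>i\<in>I. (c i)\<^sup>2) / 8))"
    by (rule integral_mono[OF integrable_finite_pmf integrable_finite_pmf]) (rule mult_left_mono[OF inner], simp)
  also have "\<dots> \<le> exp (l\<^sup>2 * (c a)\<^sup>2 / 8) * exp (l\<^sup>2 * (\<Sum>i\<in>I. (c i)\<^sup>2) / 8)"
    using outer by simp
  also have "\<dots> = exp (l\<^sup>2 * (\<Sum>i\<in>insert a I. (c i)\<^sup>2) / 8)"
    using insert.hyps by (simp add: exp_add[symmetric] add_divide_distrib distrib_left)
  finally show ?case unfolding mean .
qed

text \<open>This is McDiarmid's inequality, obtained from the exponential moment by Chernoff's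
  bound.\<close>

theorem bounded_differences_inequality:
  fixes p :: "'i \<Rightarrow> 'a::finite pmf" and f :: "('i \<Rightarrow> 'a) \<Rightarrow> real"
  assumes fin: "finite I" and t: "t > 0" and pos: "(\<Sum>i\<in>I. (c i)\<^sup>2) > 0"
    and diff: "\<And>i x y z. i \<in> I \<Longrightarrow> \<bar>f (x(i := y)) - f (x(i := z))\<bar> \<le> c i"
  shows "measure_pmf.prob (Pi_pmf I d p) {x. f x \<ge> measure_pmf.expectation (Pi_pmf I d p) f + t}
    \<le> exp (- 2 * t\<^sup>2 / (\<Sum>i\<in>I. (c i)\<^sup>2))"
proof -
  define S where "S = (\<Sum>i\<in>I. (c i)\<^sup>2)"
  define P where "P = Pi_pmf I d p"
  define \<mu> where "\<mu> = measure_pmf.expectation P f"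
  \<comment> \<open>This \<open>l\<close> minimizes the exponent
    \<open>- l * t + l\<^sup>2 * S / 8\<close>.\<close>
  define l where "l = 4 * t / S"
  have l: "l > 0" using t pos by (simp add: l_def S_def)
  have "measure_pmf.prob P {x \<in> UNIV. f x - \<mu> \<ge> t}
      \<le> exp (- l * t) * (\<integral>x\<in>UNIV. exp (l * (f x - \<mu>)) \<partial>measure_pmf P)"
    by (rule measure_pmf.Chernoff_ineq_ge[OF l])
       (auto simp: set_integrable_def P_def intro: integrable_Pi_pmf[OF fin])
  also have "\<dots> \<le> exp (- l * t) * exp (l\<^sup>2 * S / 8)"
    using bounded_differences_exp_moment[where f = f and c = c and d = d and p = p, OF fin l diff]
    by (simp add: set_lebesgue_integral_def S_def P_def \<mu>_def)
  also have "\<dots> = exp (- 2 * t\<^sup>2 / S)"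
    using pos by (simp add: exp_add[symmetric] l_def S_def[symmetric] field_simps power2_eq_square)
  also have "{x \<in> UNIV. f x - \<mu> \<ge> t} = {x. f x \<ge> \<mu> + t}" by auto
  finally show ?thesis by (simp add: P_def \<mu>_def S_def)
qed

section \<open>Deviation of vector-valued sample means\<close>

text \<open>The cross term between a new summand and the earlier sum is an inner product of
  independent vectors, and it vanishes because the new one has mean 0.\<close>

lemma expectation_norm_sum_power2:
  fixes p :: "'a::finite pmf" and Y :: "'a \<Rightarrow> 'b::euclidean_space"
  assumes "finite I" and mean: "measure_pmf.expectation p Y = 0"
  shows "measure_pmf.expectation (Pi_pmf I d (\<lambda>_. p)) (\<lambda>x. (norm (\<Sum>i\<in>I. Y (x i)))\<^sup>2)
    = real (card I) * measure_pmf.expectation p (\<lambda>y. (norm (Y y))\<^sup>2)"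
  using assms(1)
proof (induction I rule: finite_induct)
  case empty
  then show ?case by simp
next
  case (insert a I)
  let ?E = "measure_pmf.expectation (Pi_pmf I d (\<lambda>_. p))"
  let ?S = "\<lambda>x. \<Sum>i\<in>I. Y (x i)"
  note int = integrable_Pi_pmf[OF insert.hyps(1)]
  have upd: "(\<Sum>i\<in>insert a I. Y ((x(a := y)) i)) = Y y + ?S x" for x y
    using insert.hyps by (auto intro!: sum.cong)
  have "?E (\<lambda>x. (norm (Y y + ?S x))\<^sup>2)
      = (norm (Y y))\<^sup>2 + 2 * (Y y \<bullet> ?E ?S) + ?E (\<lambda>x. (norm (?S x))\<^sup>2)" for y
  proof -
    have "(norm (Y y + ?S x))\<^sup>2 = (norm (Y y))\<^sup>2 + 2 * (Y y \<bullet> ?S x) + (norm (?S x))\<^sup>2" for x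
      by (simp add: power2_norm_eq_inner inner_add_left inner_add_right inner_commute)
    then show ?thesis by (simp add: int)
  qed
  then have "measure_pmf.expectation (Pi_pmf (insert a I) d (\<lambda>_. p))
      (\<lambda>x. (norm (\<Sum>i\<in>insert a I. Y (x i)))\<^sup>2)
    = measure_pmf.expectation p
      (\<lambda>y. (norm (Y y))\<^sup>2 + 2 * (Y y \<bullet> ?E ?S) + ?E (\<lambda>x. (norm (?S x))\<^sup>2))"
    by (simp only: expectation_Pi_pmf_insert[OF insert.hyps] upd)
  also have "\<dots> = measure_pmf.expectation p (\<lambda>y. (norm (Y y))\<^sup>2) + ?E (\<lambda>x. (norm (?S x))\<^sup>2)"
    by (simp add: integrable_finite_pmf mean)
  finally show ?case using insert.hyps insert.IH by (simp add: algebra_simps)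
qed

text \<open>The variance of a summand is at most its second moment, hence at most
  \<open>D\<^sup>2\<close>. Independence makes variances add up, and the mean of the norm is at most
  the root of the mean square.\<close>

lemma expectation_norm_sample_mean:
  fixes p :: "'a::finite pmf" and Y :: "'a \<Rightarrow> 'b::euclidean_space"
  assumes fin: "finite I" and ne: "I \<noteq> {}" and D: "\<And>t. norm (Y t) \<le> D"
  defines "\<mu> \<equiv> measure_pmf.expectation p Y"
  shows "measure_pmf.expectation (Pi_pmf I d (\<lambda>_. p))
      (\<lambda>x. norm ((1 / real (card I)) *\<^sub>R (\<Sum>i\<in>I. Y (x i)) - \<mu>)) \<le> D / sqrt (real (card I))"
proof -
  define K where "K = real (card I)"
  have K: "K > 0" using fin ne by (simp add: K_def card_gt_0_iff)
  have D0: "D \<ge> 0" using D[of undefined] norm_ge_zero order_trans by blast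
  let ?E = "measure_pmf.expectation (Pi_pmf I d (\<lambda>_. p))"
  let ?N = "\<lambda>x. norm (\<Sum>i\<in>I. Y (x i) - \<mu>)"
  have "measure_pmf.expectation p (\<lambda>y. (norm (Y y - \<mu>))\<^sup>2)
      = measure_pmf.expectation p (\<lambda>y. (norm (Y y))\<^sup>2 - 2 * (Y y \<bullet> \<mu>) + (norm \<mu>)\<^sup>2)"
    by (intro Bochner_Integration.integral_cong)
       (simp_all add: power2_norm_eq_inner inner_diff_left inner_diff_right inner_commute)
  also have "\<dots> = measure_pmf.expectation p (\<lambda>y. (norm (Y y))\<^sup>2) - (norm \<mu>)\<^sup>2"
    by (simp add: integrable_finite_pmf \<mu>_def power2_norm_eq_inner)
  also have "\<dots> \<le> measure_pmf.expectation p (\<lambda>y. D\<^sup>2)"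
  proof -
    have "measure_pmf.expectation p (\<lambda>y. (norm (Y y))\<^sup>2) \<le> measure_pmf.expectation p (\<lambda>y. D\<^sup>2)"
      by (rule integral_mono[OF integrable_finite_pmf integrable_finite_pmf]) (simp add: D power_mono)
    then show ?thesis by (simp add: order_trans[rotated])
  qed
  finally have var: "measure_pmf.expectation p (\<lambda>y. (norm (Y y - \<mu>))\<^sup>2) \<le> D\<^sup>2" by simp
  \<comment> \<open>Nonnegativity of the variance of \<open>?N\<close> serves as Jensen's inequality
    for the square.\<close>
  have "(?E ?N)\<^sup>2 \<le> ?E (\<lambda>x. (?N x)\<^sup>2)"
    using measure_pmf.variance_positive[of "Pi_pmf I d (\<lambda>_. p)" ?N]
    by (subst (asm) measure_pmf.variance_eq) (auto intro: integrable_Pi_pmf[OF fin])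
  also have "\<dots> = K * measure_pmf.expectation p (\<lambda>y. (norm (Y y - \<mu>))\<^sup>2)"
    unfolding K_def by (rule expectation_norm_sum_power2[OF fin]) (simp add: integrable_finite_pmf \<mu>_def)
  also have "\<dots> \<le> K * D\<^sup>2" using var K by simp
  also have "\<dots> = (sqrt K * D)\<^sup>2" using K by (simp add: power_mult_distrib)
  finally have EN: "?E ?N \<le> sqrt K * D" using K D0 by (auto intro: power2_le_imp_le)
  have "(1 / K) *\<^sub>R (\<Sum>i\<in>I. Y (x i)) - \<mu> = (1 / K) *\<^sub>R (\<Sum>i\<in>I. Y (x i) - \<mu>)" for x
    using K by (simp add: sum_subtractf scaleR_diff_right sum_constant_scaleR K_def)
  then have "?E (\<lambda>x. norm ((1 / K) *\<^sub>R (\<Sum>i\<in>I. Y (x i)) - \<mu>)) = ?E ?N / K"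
    using K by simp
  also have "\<dots> \<le> sqrt K * D / K" using EN K by (simp add: divide_right_mono)
  also have "\<dots> = D / sqrt K" using K by (simp add: field_simps real_sqrt_mult_self)
  finally show ?thesis by (simp add: K_def)
qed

text \<open>The summand 1 in the factor pays for the expected deviation, the square root for the
  fluctuation around it. The bound does not depend on the dimension, since bounded differences is
  applied to the norm itself.\<close>

lemma sample_mean_deviation:
  fixes p :: "'a::finite pmf" and Y :: "'a \<Rightarrow> 'b::euclidean_space"
  assumes fin: "finite I" and ne: "I \<noteq> {}" and D: "\<And>t. norm (Y t) \<le> D" "D > 0"
    and \<eta>: "0 < \<eta>" "\<eta> < 1"
  defines "\<mu> \<equiv> measure_pmf.expectation p Y"
  shows "measure_pmf.prob (Pi_pmf I d (\<lambda>_. p))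
      {x. norm ((1 / real (card I)) *\<^sub>R (\<Sum>i\<in>I. Y (x i)) - \<mu>)
        \<ge> D / sqrt (real (card I)) * (1 + sqrt (2 * ln (1 / \<eta>)))} \<le> \<eta>"
proof -
  define K where "K = real (card I)"
  have K: "K > 0" using fin ne by (simp add: K_def card_gt_0_iff)
  define P where "P = Pi_pmf I d (\<lambda>_. p)"
  define f where "f x = norm ((1 / K) *\<^sub>R (\<Sum>i\<in>I. Y (x i)) - \<mu>)" for x
  define t where "t = D / sqrt K * sqrt (2 * ln (1 / \<eta>))"
  have ln: "ln (1 / \<eta>) > 0" using \<eta> by simp
  have t: "t > 0" using D ln K by (simp add: t_def)
  \<comment> \<open>Replacing one draw moves the sample mean by at most \<open>2 * D / K\<close>.
    With this sum of squares, \<open>t\<close> is exactly the value for which the tail bound equals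
    \<open>\<eta>\<close>.\<close>
  have sumc: "(\<Sum>i\<in>I. (2 * D / K)\<^sup>2) = 4 * D\<^sup>2 / K"
    using K by (simp add: K_def[symmetric] power_divide power2_eq_square)
  have mean: "measure_pmf.expectation P f \<le> D / sqrt K"
    using expectation_norm_sample_mean[OF fin ne D(1), where p = p and d = d]
    by (simp add: P_def f_def[abs_def] K_def \<mu>_def)
  have "measure_pmf.prob P {x. f x \<ge> D / sqrt K * (1 + sqrt (2 * ln (1 / \<eta>)))}
      \<le> measure_pmf.prob P {x. f x \<ge> measure_pmf.expectation P f + t}"
    using mean by (intro measure_pmf.finite_measure_mono) (auto simp: t_def distrib_left)
  also have "\<dots> \<le> exp (- 2 * t\<^sup>2 / (\<Sum>i\<in>I. (2 * D / K)\<^sup>2))"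
    unfolding P_def
  proof (rule bounded_differences_inequality[OF fin t])
    show "(\<Sum>i\<in>I. (2 * D / K)\<^sup>2) > 0" unfolding sumc using D K by simp
    fix i x y z assume i: "i \<in> I"
    have upd: "(\<Sum>j\<in>I. Y ((x(i := u)) j)) = Y u + (\<Sum>j\<in>I - {i}. Y (x j))" for u
      using fin i by (subst sum.remove[of _ i]) (auto intro!: sum.cong)
    have "\<bar>f (x(i := y)) - f (x(i := z))\<bar> \<le> norm ((1 / K) *\<^sub>R (Y y - Y z))"
      unfolding f_def upd
      by (rule order_trans[OF norm_triangle_ineq3]) (simp add: algebra_simps)
    also have "\<dots> = norm (Y y - Y z) / K" using K by simp
    also have "\<dots> \<le> 2 * D / K"
      using norm_triangle_ineq4[of "Y y" "Y z"] D(1)[of y] D(1)[of z] K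
      by (intro divide_right_mono) auto
    finally show "\<bar>f (x(i := y)) - f (x(i := z))\<bar> \<le> 2 * D / K" .
  qed
  also have "- 2 * t\<^sup>2 / (\<Sum>i\<in>I. (2 * D / K)\<^sup>2) = - ln (1 / \<eta>)"
    unfolding sumc t_def using K D ln
    by (simp add: power_mult_distrib power_divide real_sqrt_pow2 del: ln_div)
  also have "exp (- ln (1 / \<eta>)) = \<eta>" using \<eta> by (simp add: exp_minus)
  finally show ?thesis by (simp add: P_def f_def K_def)
qed

text \<open>This carries the concentration bounds, proved for product distributions, to arbitrary
  independent draws. There are finitely many tuples, so an event on the draws is a finite disjoint
  union of atoms, whose probabilities factor by independence.\<close>

lemma (in prob_space) prob_indep_tuple_eq_Pi_pmf:
  fixes X :: "'k::finite \<Rightarrow> 'a \<Rightarrow> 'n::finite"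
  assumes indep: "indep_vars (\<lambda>_. count_space UNIV) X UNIV"
    and law: "\<And>k t. prob {\<omega> \<in> space M. X k \<omega> = t} = pmf (p k) t"
  shows "prob {\<omega> \<in> space M. Q (\<lambda>k. X k \<omega>)} = measure_pmf.prob (Pi_pmf UNIV d p) {x. Q x}"
proof -
  let ?F = "\<lambda>x k. X k -` {x k} \<inter> space M"
  have rv: "random_variable (count_space UNIV) (X k)" for k
    using indep unfolding indep_vars_def by auto
  have ev: "(\<Inter>k. ?F x k) \<in> events" for x
    by (intro sets.finite_INT) (auto intro!: measurable_sets[OF rv])
  have single: "prob (\<Inter>k. ?F x k) = pmf (Pi_pmf UNIV d p) x" for x
  proof -
    have "indep_sets (\<lambda>k. {X k -` A \<inter> space M |A. A \<in> sets (count_space UNIV)}) UNIV"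
      using indep unfolding indep_vars_def2 by simp
    from indep_setsD[OF this, of UNIV "?F x"]
    have "prob (\<Inter>k. ?F x k) = (\<Prod>k\<in>UNIV. prob (?F x k))" by auto
    also have "\<dots> = (\<Prod>k\<in>UNIV. pmf (p k) (x k))"
    proof (rule prod.cong[OF refl])
      fix k
      have "?F x k = {\<omega> \<in> space M. X k \<omega> = x k}" by auto
      then show "prob (?F x k) = pmf (p k) (x k)" using law by simp
    qed
    also have "\<dots> = pmf (Pi_pmf UNIV d p) x" by (rule pmf_Pi'[symmetric]) auto
    finally show ?thesis .
  qed
  have "{\<omega> \<in> space M. Q (\<lambda>k. X k \<omega>)} = (\<Union>x\<in>{x. Q x}. \<Inter>k. ?F x k)"
  proof (intro equalityI subsetI)
    fix \<omega> assume "\<omega> \<in> {\<omega> \<in> space M. Q (\<lambda>k. X k \<omega>)}"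
    then show "\<omega> \<in> (\<Union>x\<in>{x. Q x}. \<Inter>k. ?F x k)" by (intro UN_I[of "\<lambda>k. X k \<omega>"]) auto
  next
    fix \<omega> assume "\<omega> \<in> (\<Union>x\<in>{x. Q x}. \<Inter>k. ?F x k)"
    then obtain x where "Q x" "\<omega> \<in> space M" "x = (\<lambda>k. X k \<omega>)" by auto
    then show "\<omega> \<in> {\<omega> \<in> space M. Q (\<lambda>k. X k \<omega>)}" by simp
  qed
  also have "prob \<dots> = (\<Sum>x\<in>{x. Q x}. prob (\<Inter>k. ?F x k))"
  proof (rule finite_measure_finite_Union)
    show "disjoint_family_on (\<lambda>x. \<Inter>k. ?F x k) {x. Q x}"
      by (auto simp: disjoint_family_on_def)
  qed (use ev in auto)
  also have "\<dots> = measure_pmf.prob (Pi_pmf UNIV d p) {x. Q x}"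
    unfolding single by (simp add: measure_measure_pmf_finite)
  finally show ?thesis .
qed

subsection \<open>Column randomization\<close>

lemma lp_value_finite:
  assumes "lp_feasible A b" "lp_bounded A b c"
  obtains v where "lp_value A b c = ereal v"
proof -
  obtain x where x: "x \<in> lp_feasible_set A b" using assms(1) by (auto simp: lp_feasible_def)
  obtain l where l: "\<And>y. y \<in> lp_feasible_set A b \<Longrightarrow> l \<le> c \<bullet> y"
    using assms(2) by (auto simp: lp_bounded_def bdd_below_def)
  have "lp_value A b c \<le> ereal (c \<bullet> x)"
    unfolding lp_value_def min_value_def using x by (rule INF_lower)
  moreover have "ereal l \<le> lp_value A b c"
    unfolding lp_value_def min_value_def using l by (intro INF_greatest) simp
  ultimately show ?thesis using that by (cases "lp_value A b c") auto
qed

lemma compact_lp_box_feasible_set: "compact (lp_box_feasible_set A b u)"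
proof -
  have "closed {x. A *v x = b}"
    by (intro closed_Collect_eq continuous_intros matrix_vector_mult_linear_continuous_on)
  moreover have "lp_box_feasible_set A b u = cbox 0 u \<inter> {x. A *v x = b}"
    by (auto simp: lp_box_feasible_set_def mem_box_cart less_eq_vec_def)
  ultimately show ?thesis using compact_Int_closed compact_cbox by metis
qed

lemma lp_box_value_attained:
  assumes "lp_box_feasible_set A b u \<noteq> {}"
  obtains x where "x \<in> lp_box_feasible_set A b u" "lp_box_value A b c u = ereal (c \<bullet> x)"
proof -
  have "continuous_on (lp_box_feasible_set A b u) (\<lambda>x. c \<bullet> x)" by (intro continuous_intros)
  then obtain x where x: "x \<in> lp_box_feasible_set A b u"
    "\<And>y. y \<in> lp_box_feasible_set A b u \<Longrightarrow> c \<bullet> x \<le> c \<bullet> y"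
    using continuous_attains_inf[OF compact_lp_box_feasible_set assms] by blast
  have "lp_box_value A b c u = ereal (c \<bullet> x)"
    unfolding lp_box_value_def min_value_def
    by (intro antisym INF_lower2[OF x(1)] INF_greatest) (auto simp: x(2))
  then show ?thesis using that x(1) by blast
qed

theorem mainTheorem7:
  fixes A :: "real ^ 'n ^ 'm" and b :: "real ^ 'm" and c :: "real ^ 'n"
    and \<xi> :: "real ^ 'n" and C \<delta> :: real
    and M :: "'w measure" and j :: "'k::finite \<Rightarrow> 'w \<Rightarrow> 'n"
  assumes "lp_feasible A b"
    and "lp_bounded A b c"
    and "rank A = CARD('m)"
    and "norm c = 1"
    and "totally_unimodular A"
    and "\<forall>t. 0 \<le> \<xi> $ t"
    and "(\<Sum>t\<in>UNIV. \<xi> $ t) = 1"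
    and "prob_space M"
    and "prob_space.indep_vars M (\<lambda>_. count_space UNIV) j UNIV"
    and "\<forall>k t. measure M {\<omega> \<in> space M. j k \<omega> = t} = \<xi> $ t"
    and "0 < C"
    and "0 < \<delta>" and "\<delta> < 1"
  shows "measure M {\<omega> \<in> space M.
           lp_feasible (select_columns A (\<lambda>k. j k \<omega>)) b \<and>
           rank (select_columns A (\<lambda>k. j k \<omega>)) = CARD('m) \<longrightarrow>
           lp_value (select_columns A (\<lambda>k. j k \<omega>)) b (select_entries c (\<lambda>k. j k \<omega>))
             - lp_value A b c
           \<le> (lp_box_value A b c (C *\<^sub>R \<xi>) - lp_value A b c)
             + ereal (C * (1 + (real CARD('m))\<^sup>2 * infnorm c) / sqrt (real CARD('k))
                      * (1 + sqrt (2 * ln (2 / \<delta>))))}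
         \<ge> 1 - \<delta>"
proof -
  interpret prob_space M by fact
  \<comment> \<open>Finiteness of the optimal value makes the extended-real differences in the claim
    behave like real ones.\<close>
  obtain v where v: "lp_value A b c = ereal v"
    using lp_value_finite assms(1,2) by blast
  define B where "B = C * (1 + (real CARD('m))\<^sup>2 * infnorm c) / sqrt (real CARD('k))
                      * (1 + sqrt (2 * ln (2 / \<delta>)))"
  define Q where "Q J \<longleftrightarrow> (lp_feasible (select_columns A J) b \<and>
           rank (select_columns A J) = CARD('m) \<longrightarrow>
           lp_value (select_columns A J) b (select_entries c J) - lp_value A b c
           \<le> (lp_box_value A b c (C *\<^sub>R \<xi>) - lp_value A b c) + ereal B)" for J :: "'k \<Rightarrow> 'n"
  have "prob {\<omega> \<in> space M. Q (\<lambda>k. j k \<omega>)} \<ge> 1 - \<delta>"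
  \<comment> \<open>If the box problem is infeasible, the right-hand side is infinite and every
    sample satisfies the claim.\<close>
  proof (cases "lp_box_feasible_set A b (C *\<^sub>R \<xi>) = {}")
    case True
    then have "lp_box_value A b c (C *\<^sub>R \<xi>) = \<infinity>"
      by (simp add: lp_box_value_def min_value_def top_ereal_def)
    then have "{\<omega> \<in> space M. Q (\<lambda>k. j k \<omega>)} = space M" by (auto simp: Q_def v)
    then show ?thesis using prob_space assms by simp
  next
    case False
    then obtain x where "x \<in> lp_box_feasible_set A b (C *\<^sub>R \<xi>)"
      and val: "lp_box_value A b c (C *\<^sub>R \<xi>) = ereal (c \<bullet> x)"
      using lp_box_value_attained by blast
    then have Ax: "A *v x = b" and x0: "0 \<le> x $ t" and xC: "x $ t \<le> C * \<xi> $ t" for t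
      by (auto simp: lp_box_feasible_set_def less_eq_vec_def)
    define p where "p = embed_pmf (\<lambda>t. \<xi> $ t)"
    have "(\<integral>\<^sup>+t. ennreal (\<xi> $ t) \<partial>count_space UNIV) = 1"
      using assms(6,7) by (simp add: nn_integral_count_space_finite sum_ennreal)
    then have p: "pmf p t = \<xi> $ t" for t
      unfolding p_def using assms(6) by (intro pmf_embed_pmf) auto
    \<comment> \<open>The importance weights. If \<open>\<xi> $ t = 0\<close>, the box forces
      \<open>x $ t = 0\<close> and division by zero makes the weight 0, so \<open>wx\<close> holds
      there too. The box bound gives \<open>w t \<le> C\<close>.\<close>
    define w where "w t = x $ t / \<xi> $ t" for t
    have w0: "0 \<le> w t" for t using x0 assms(6) by (simp add: w_def)
    have wC: "w t \<le> C" for t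
      using xC[of t] assms(6,11) by (cases "\<xi> $ t = 0") (auto simp: w_def divide_le_eq less_le mult.commute)
    have wx: "\<xi> $ t * (w t * a) = a * x $ t" for t a
      using xC[of t] x0[of t] by (cases "\<xi> $ t = 0") (auto simp: w_def)
    have Apm: "\<bar>A $ i $ t\<bar> \<le> 1" for i t
      by (rule totally_unimodular_entry_le_1[OF assms(5)])
    define K where "K = real CARD('k)"
    have K: "K > 0" by (simp add: K_def)
    define m where "m = real CARD('m)"
    have m: "m > 0" by (simp add: m_def)
    define s where "s = 1 + sqrt (2 * ln (2 / \<delta>))"
    \<comment> \<open>\<open>U\<close> and \<open>V\<close> are the weighted column and cost of one
      draw; their means are \<open>b\<close> and \<open>c \<bullet> x\<close>. Entries of
      \<open>A\<close> are at most 1 in absolute value, which gives the bound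
      \<open>C * sqrt m\<close> on \<open>U\<close>.\<close>
    define U where "U t = (\<chi> i. w t * A $ i $ t)" for t
    define V where "V t = w t * c $ t" for t
    have V: "norm (V t) \<le> C" for t
    proof -
      have "\<bar>c $ t\<bar> \<le> 1" using component_le_norm_cart[of c t] assms(4) by simp
      then show ?thesis using w0[of t] wC[of t] mult_mono[of "w t" C "\<bar>c $ t\<bar>" 1] assms(11)
        by (simp add: V_def abs_mult)
    qed
    have U: "norm (U t) \<le> C * sqrt m" for t
    proof -
      have "\<bar>U t $ i\<bar> \<le> C" for i
        using w0[of t] wC[of t] mult_mono[of "w t" C "\<bar>A $ i $ t\<bar>" 1] assms(11) Apm[of i t]
        by (simp add: U_def abs_mult)
      then have "norm (U t) \<le> L2_set (\<lambda>_. C) (UNIV :: 'm set)"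
        unfolding norm_vec_def by (intro L2_set_mono) auto
      also have "\<dots> = C * sqrt m" using assms(11) by (simp add: L2_set_def m_def real_sqrt_mult)
      finally show ?thesis .
    qed
    have EU: "measure_pmf.expectation p U = b"
    proof -
      have "measure_pmf.expectation p U = (\<Sum>t\<in>UNIV. \<xi> $ t *\<^sub>R U t)"
        by (subst integral_measure_pmf[of UNIV]) (auto simp: p)
      also have "\<dots> = A *v x"
        by (simp add: vec_eq_iff U_def matrix_vector_mult_def wx)
      finally show ?thesis using Ax by simp
    qed
    have EV: "measure_pmf.expectation p V = c \<bullet> x"
    proof -
      have "measure_pmf.expectation p V = (\<Sum>t\<in>UNIV. \<xi> $ t *\<^sub>R V t)"
        by (subst integral_measure_pmf[of UNIV]) (auto simp: p)
      also have "\<dots> = c \<bullet> x"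
        by (simp add: V_def inner_vec_def wx)
      finally show ?thesis .
    qed
    define P where "P = Pi_pmf (UNIV :: 'k set) undefined (\<lambda>_. p)"
    define BU :: "('k \<Rightarrow> 'n) set" where "BU = {J. norm ((1 / K) *\<^sub>R (\<Sum>k\<in>UNIV. U (J k)) - b) \<ge> C * sqrt m / sqrt K * s}"
    define BV :: "('k \<Rightarrow> 'n) set" where "BV = {J. norm ((1 / K) *\<^sub>R (\<Sum>k\<in>UNIV. V (J k)) - c \<bullet> x) \<ge> C / sqrt K * s}"
    \<comment> \<open>Each of the two bad events gets half of the failure probability, which is the
      origin of the 2 in \<open>ln (2 / \<delta>)\<close>.\<close>
    have half: "0 < \<delta> / 2" "\<delta> / 2 < 1" "1 / (\<delta> / 2) = 2 / \<delta>" using assms(12,13) by auto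
    have "C * sqrt m > 0" using assms(11) m by simp
    from sample_mean_deviation[where Y = U and I = "UNIV :: 'k set" and p = p and d = undefined,
        OF finite UNIV_not_empty U this half(1,2)]
    have PU: "measure_pmf.prob P BU \<le> \<delta> / 2"
      unfolding P_def BU_def EU half(3) K_def s_def by simp
    from sample_mean_deviation[where Y = V and I = "UNIV :: 'k set" and p = p and d = undefined,
        OF finite UNIV_not_empty V assms(11) half(1,2)]
    have PV: "measure_pmf.prob P BV \<le> \<delta> / 2"
      unfolding P_def BV_def EV half(3) K_def s_def by simp
    have good: "Q J" if J: "J \<notin> BU" "J \<notin> BV" for J
      unfolding Q_def
    proof (intro impI, elim conjE)
      assume feas: "lp_feasible (select_columns A J) b"
      \<comment> \<open>With this \<open>y\<close>, constraint and objective values are the sample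
        means of \<open>U\<close> and \<open>V\<close>, so outside the bad events both are close to
        \<open>b\<close> and \<open>c \<bullet> x\<close>.\<close>
      define y :: "real ^ 'k" where "y = (\<chi> k. w (J k) / K)"
      have Ay: "select_columns A J *v y = (1 / K) *\<^sub>R (\<Sum>k\<in>UNIV. U (J k))"
        by (simp add: vec_eq_iff select_columns_def matrix_vector_mult_def y_def U_def
            sum_divide_distrib mult.commute)
      have cy: "select_entries c J \<bullet> y = (1 / K) *\<^sub>R (\<Sum>k\<in>UNIV. V (J k))"
        by (simp add: select_entries_def inner_vec_def y_def V_def sum_divide_distrib mult.commute)
      have y0: "0 \<le> y" using w0 K by (simp add: less_eq_vec_def y_def)
      have cJ: "\<bar>select_entries c J $ k\<bar> \<le> infnorm c" for k
        by (simp add: select_entries_def component_le_infnorm_cart)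
      have "lp_value (select_columns A J) b (select_entries c J)
          \<le> ereal (select_entries c J \<bullet> y
              + infnorm c * m * sqrt m * norm (select_columns A J *v y - b))"
        unfolding m_def
        by (rule totally_unimodular_lp_value_le[OF totally_unimodular_select_columns[OF assms(5)]
              feas y0 cJ])
      also have "select_entries c J \<bullet> y + infnorm c * m * sqrt m * norm (select_columns A J *v y - b)
          \<le> (c \<bullet> x + C / sqrt K * s) + infnorm c * m * sqrt m * (C * sqrt m / sqrt K * s)"
      proof (rule add_mono)
        show "select_entries c J \<bullet> y \<le> c \<bullet> x + C / sqrt K * s"
          using J(2) unfolding BV_def cy by (simp add: abs_less_iff)
        show "infnorm c * m * sqrt m * norm (select_columns A J *v y - b)
            \<le> infnorm c * m * sqrt m * (C * sqrt m / sqrt K * s)"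
          using J(1) m unfolding BU_def Ay
          by (intro mult_left_mono) (auto simp: infnorm_pos_le)
      qed
      \<comment> \<open>The objective error contributes the 1. The repair factor
        \<open>m * sqrt m\<close> meets the \<open>sqrt m\<close> from the norm of \<open>U\<close>
        and yields \<open>m\<^sup>2\<close>.\<close>
      also have "\<dots> = c \<bullet> x + B"
      proof -
        have "infnorm c * m * sqrt m * (C * sqrt m / sqrt K * s)
            = infnorm c * m * (sqrt m * sqrt m) * C / sqrt K * s" by (simp add: algebra_simps)
        also have "sqrt m * sqrt m = m" using m by simp
        finally show ?thesis
          by (simp add: B_def m_def K_def s_def power2_eq_square add_divide_distrib algebra_simps)
      qed
      finally have "lp_value (select_columns A J) b (select_entries c J) - ereal v
          \<le> ereal (c \<bullet> x + B) - ereal v"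
        by (intro ereal_minus_mono) auto
      then show "lp_value (select_columns A J) b (select_entries c J) - lp_value A b c
           \<le> (lp_box_value A b c (C *\<^sub>R \<xi>) - lp_value A b c) + ereal B"
        unfolding v val by (simp add: algebra_simps)
    qed
    have "measure_pmf.prob P (BU \<union> BV) \<le> \<delta>"
      using measure_Un_le[of BU "measure_pmf P" BV] PU PV by simp
    then have "1 - \<delta> \<le> measure_pmf.prob P (- (BU \<union> BV))"
      using measure_pmf.prob_compl[of "BU \<union> BV" P] by (simp add: Compl_eq_Diff_UNIV)
    also have "\<dots> \<le> measure_pmf.prob P {J. Q J}"
      by (rule measure_pmf.finite_measure_mono) (use good in auto)
    also have "\<dots> = prob {\<omega> \<in> space M. Q (\<lambda>k. j k \<omega>)}"
      unfolding P_def by (rule prob_indep_tuple_eq_Pi_pmf[symmetric]) (use assms(9,10) p in auto)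
    finally show ?thesis .
  qed
  then show ?thesis by (simp only: Q_def B_def)
qed

end
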